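(* If pointed $T_1$-spaces $X_n$, $n\in\omega$, have countable Pytkeev networks, then their small box-product $\boxdot_{n\in\omega}X_n$ has a countable Pytkeev network.
   Context: A pointed topological space is a topological space $X$ with a distinguished point $*_X$. The box product $\square_{n\in\omega}X_n$ is the Cartesian product $\prod_{n\in\omega}X_n$ endowed with the topology generated by the base consisting of the products $\prod_{n\in\omega}U_n$ of open sets $U_n\subset X_n$. The small box-product of pointed topological spaces $X_n$, $n\in\omega$, is the subspace $$\boxdot_{n\in\omega}X_n=\{(x_n)_{n\in\omega}\in\square_{n\in\omega}X_n:\text{ the set }\{n\in\omega:x_n\neq *_{X_n}\}\text{ is finite}\}$$ of the box product. A subset $A$ of a topological space $X$ accumulates at a point $x\in X$ if each neighborhood of $x$ contains infinitely many points of $A$. A family $\mathcal N$ of subsets of $X$ is a network at $x\in X$ if for any neighborhood $O_x$ of $x$ there is $N\in\mathcal N$ with $x\in N\subset O_x$. It is a Pytkeev network at $x$ if it is a network at $x$ and for each neighborhood $O_x$ of $x$ and each subset $A\subset X$ accumulating at $x$ there is $N\in\mathcal N$ such that $N\subset O_x$ and $N\cap A$ is infinite. It is a Pytkeev network for $X$ if it is a Pytkeev network at each point $x\in X$. *)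

theory Defs
  imports "HOL-Analysis.Analysis"
begin

text \<open>
  Spaces are values of type \<^typ>\<open>'a topology\<close> whose points form \<^const>\<open>topspace\<close>. Throughout,
  neighborhoods of a point are the open sets containing it.
\<close>

definition accumulates_at :: "'a topology \<Rightarrow> 'a set \<Rightarrow> 'a \<Rightarrow> bool" where
  "accumulates_at X A x \<longleftrightarrow>
     A \<subseteq> topspace X \<and> x \<in> topspace X \<and> (\<forall>U. openin X U \<and> x \<in> U \<longrightarrow> infinite (U \<inter> A))"

definition network_at :: "'a topology \<Rightarrow> 'a set set \<Rightarrow> 'a \<Rightarrow> bool" where
  "network_at X \<N> x \<longleftrightarrow>
     \<N> \<subseteq> Pow (topspace X) \<and>
     (\<forall>U. openin X U \<and> x \<in> U \<longrightarrow> (\<exists>N\<in>\<N>. x \<in> N \<and> N \<subseteq> U))"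

definition pytkeev_network_at :: "'a topology \<Rightarrow> 'a set set \<Rightarrow> 'a \<Rightarrow> bool" where
  "pytkeev_network_at X \<N> x \<longleftrightarrow>
     network_at X \<N> x \<and>
     (\<forall>U A. openin X U \<and> x \<in> U \<and> accumulates_at X A x \<longrightarrow>
        (\<exists>N\<in>\<N>. N \<subseteq> U \<and> infinite (N \<inter> A)))"

definition pytkeev_network :: "'a topology \<Rightarrow> 'a set set \<Rightarrow> bool" where
  "pytkeev_network X \<N> \<longleftrightarrow>
     \<N> \<subseteq> Pow (topspace X) \<and> (\<forall>x\<in>topspace X. pytkeev_network_at X \<N> x)"

definition box_product :: "(nat \<Rightarrow> 'a topology) \<Rightarrow> (nat \<Rightarrow> 'a) topology" where
  "box_product X = topology_generated_by {Pi\<^sub>E UNIV U |U. \<forall>n. openin (X n) (U n)}"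

definition small_box_product :: "(nat \<Rightarrow> 'a topology) \<Rightarrow> (nat \<Rightarrow> 'a) \<Rightarrow> (nat \<Rightarrow> 'a) topology" where
  "small_box_product X p =
     subtopology (box_product X) {x \<in> topspace (box_product X). finite {n. x n \<noteq> p n}}"

lemma topspace_box_product: "topspace (box_product X) = (\<Pi>\<^sub>E n\<in>UNIV. topspace (X n))"
proof
  show "topspace (box_product X) \<subseteq> (\<Pi>\<^sub>E n\<in>UNIV. topspace (X n))"
    unfolding box_product_def topology_generated_by_topspace
    using openin_subset by (fastforce simp: PiE_iff)
  show "(\<Pi>\<^sub>E n\<in>UNIV. topspace (X n)) \<subseteq> topspace (box_product X)"
    unfolding box_product_def topology_generated_by_topspace
    by (intro Union_upper) auto
qed

text \<open>The generating boxes form a base, not merely a subbase.\<close>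

lemma openin_box_product_iff:
  "openin (box_product X) S \<longleftrightarrow>
     (\<forall>x\<in>S. \<exists>U. (\<forall>n. openin (X n) (U n)) \<and> x \<in> Pi\<^sub>E UNIV U \<and> Pi\<^sub>E UNIV U \<subseteq> S)"
  (is "_ \<longleftrightarrow> ?base S")
proof
  let ?B = "{Pi\<^sub>E UNIV U |U. \<forall>n. openin (X n) (U n)}"
  show "?base S" if "openin (box_product X) S"
  proof -
    have "generate_topology_on ?B S"
      using that by (simp add: box_product_def openin_topology_generated_by_iff)
    then show ?thesis
    proof induction
      case (Int a b)
      show ?case
      proof
        fix x assume "x \<in> a \<inter> b"
        then obtain U V where
          "\<forall>n. openin (X n) (U n)" "x \<in> Pi\<^sub>E UNIV U" "Pi\<^sub>E UNIV U \<subseteq> a"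
          "\<forall>n. openin (X n) (V n)" "x \<in> Pi\<^sub>E UNIV V" "Pi\<^sub>E UNIV V \<subseteq> b"
          using Int.IH by (meson IntD1 IntD2)
        then show "\<exists>W. (\<forall>n. openin (X n) (W n)) \<and> x \<in> Pi\<^sub>E UNIV W \<and> Pi\<^sub>E UNIV W \<subseteq> a \<inter> b"
          by (intro exI[of _ "\<lambda>n. U n \<inter> V n"]) (auto simp: PiE_Int[symmetric])
      qed
    next
      case (UN K)
      then show ?case by (meson Union_iff Union_upper subset_trans)
    qed auto
  qed
  show "openin (box_product X) S" if "?base S"
  proof (subst openin_subopen, intro ballI)
    fix x assume "x \<in> S"
    with that obtain U where U: "\<forall>n. openin (X n) (U n)" "x \<in> Pi\<^sub>E UNIV U" "Pi\<^sub>E UNIV U \<subseteq> S"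
      by blast
    then have "openin (box_product X) (Pi\<^sub>E UNIV U)"
      unfolding box_product_def by (intro topology_generated_by_Basis) blast
    with U show "\<exists>T. openin (box_product X) T \<and> x \<in> T \<and> T \<subseteq> S" by blast
  qed
qed

end

theory Submission
  imports Defs
begin

text \<open>
  Fix a point \<open>x\<close> of the small box product, a box \<open>\<Prod>i. U i\<close> around it, and \<open>k0\<close> beyond which
  \<open>x i = p i\<close>. In each factor, finite unions of members of a countable Pytkeev network
  yield an increasing sequence \<open>C i 0 \<subseteq> C i 1 \<subseteq> \<dots>\<close> that starts at a set containing \<open>x i\<close>,
  exhausts \<open>U i\<close>, and eventually meets every set accumulating at \<open>x i\<close> infinitely often
  (\<open>pytkeev_exhaustion\<close>). Consider the truncated boxes
  \<open>F k = \<Prod>i<k. C i k \<times> \<Prod>i\<ge>k. {p i}\<close>. They are given by finite lists of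
  members of a countable family, so over all \<open>x\<close> and \<open>U\<close> only countably many of them arise,
  although there are in general uncountably many boxes \<open>U\<close>; and for \<open>k \<ge> k0\<close> they contain \<open>x\<close>
  and lie in the box. The required network consists of the sets of this kind.

  The point is that a set \<open>A\<close> accumulating at \<open>x\<close> meets some \<open>F k\<close> infinitely often
  (\<open>truncated_box_meets_infinitely\<close>). Suppose it does not. Every point of \<open>A\<close> in the box but
  outside \<open>F k0\<close> enters the increasing sequence \<open>F\<close> at some stage \<open>k + 1\<close>, and some coordinate
  \<open>i\<close> is to blame for its not being in \<open>F k\<close> already. Let \<open>P i\<close> be the set of the \<open>i\<close>-th coordinates
  of the points blamed on \<open>i\<close>. For \<open>j > i\<close> and \<open>j \<ge> k0\<close>, a point blamed on \<open>i\<close> whose \<open>i\<close>-th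
  coordinate lies in \<open>C i j\<close> has entered by stage \<open>j\<close>, so \<open>P i\<close> has only finitely many points in each \<open>C i j\<close>. Thus \<open>P i\<close> does not accumulate
  at \<open>x i\<close>, and, because \<open>x i \<notin> P i\<close>, the \<open>T\<^sub>1\<close> axiom gives a neighborhood of \<open>x i\<close> that
  misses \<open>P i\<close> altogether. Missing it altogether is essential: a finite remainder in each of
  infinitely many coordinates would not do. The product of these neighborhoods contains no
  point of \<open>A\<close> outside the finite set \<open>A \<inter> F k0\<close>, which contradicts accumulation.
\<close>

section \<open>Exhausting an open set along a Pytkeev network\<close>

text \<open>
  The form in which the Pytkeev property of a factor is used: finite unions turn the
  members of a countable network inside \<open>U\<close> into one increasing sequence. Starting it at a set that
  contains \<open>x\<close> ensures that \<open>x\<close> itself is never the reason for a point to enter late.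
\<close>

lemma pytkeev_exhaustion:
  assumes "countable \<N>" and net: "pytkeev_network X \<N>"
    and U: "openin X U" "x \<in> U"
  shows "\<exists>C. range C \<subseteq> Union ` {\<F>. finite \<F> \<and> \<F> \<subseteq> \<N>} \<and> incseq C \<and> x \<in> C 0 \<and> (\<Union>k. C k) = U \<and>
    (\<forall>A. accumulates_at X A x \<longrightarrow> (\<exists>k. infinite (C k \<inter> A)))"
proof -
  define \<S> where "\<S> = {N \<in> \<N>. N \<subseteq> U}"
  have at: "pytkeev_network_at X \<N> y" if "y \<in> U" for y
    using net openin_subset[OF U(1)] that by (auto simp: pytkeev_network_def)
  have network: "\<exists>N\<in>\<S>. y \<in> N" if "y \<in> U" for y
  proof -
    have "\<exists>N\<in>\<N>. y \<in> N \<and> N \<subseteq> U"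
      using at[OF that] U(1) that by (simp add: pytkeev_network_at_def network_at_def)
    then show ?thesis
      by (auto simp: \<S>_def)
  qed
  obtain N0 where N0: "N0 \<in> \<S>" "x \<in> N0"
    using network[OF U(2)] by blast
  define e where "e = from_nat_into \<S>"
  have "countable \<S>"
    using \<open>countable \<N>\<close> by (simp add: \<S>_def)
  then have range_e: "range e = \<S>"
    using N0(1) unfolding e_def by (intro range_from_nat_into) auto
  define C where "C k = \<Union> (insert N0 (e ` {..k}))" for k
  have e_C: "e k \<subseteq> C k" for k
    by (auto simp: C_def)
  have "range C \<subseteq> Union ` {\<F>. finite \<F> \<and> \<F> \<subseteq> \<N>}"
  proof
    fix D assume "D \<in> range C"
    then obtain k where "D = \<Union> (insert N0 (e ` {..k}))"
      by (auto simp: C_def)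
    moreover have "insert N0 (e ` {..k}) \<subseteq> \<N>"
      using N0(1) range_e by (auto simp: \<S>_def)
    ultimately show "D \<in> Union ` {\<F>. finite \<F> \<and> \<F> \<subseteq> \<N>}"
      by blast
  qed
  moreover have "incseq C"
    by (fastforce simp: incseq_def C_def)
  moreover have "x \<in> C 0"
    using N0(2) by (simp add: C_def)
  moreover have "(\<Union>k. C k) = U"
  proof
    show "(\<Union>k. C k) \<subseteq> U"
      using N0(1) range_e by (auto simp: C_def \<S>_def)
    show "U \<subseteq> (\<Union>k. C k)"
      using network e_C unfolding range_e[symmetric] by blast
  qed
  moreover have "\<exists>k. infinite (C k \<inter> A)" if "accumulates_at X A x" for A
  proof -
    have "\<exists>N\<in>\<N>. N \<subseteq> U \<and> infinite (N \<inter> A)"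
      using at[OF U(2)] U that by (simp add: pytkeev_network_at_def)
    then obtain N where N: "N \<in> \<S>" "infinite (N \<inter> A)"
      by (auto simp: \<S>_def)
    then obtain k where "N = e k"
      using range_e by blast
    then have "infinite (C k \<inter> A)"
      using N(2) e_C[of k] by (meson Int_mono finite_subset subset_refl)
    then show ?thesis ..
  qed
  ultimately show ?thesis
    by (intro exI[of _ C]) simp
qed

section \<open>The topology of the small box product\<close>

lemma topspace_small_box_product:
  "topspace (small_box_product X p) = {x. (\<forall>n. x n \<in> topspace (X n)) \<and> finite {n. x n \<noteq> p n}}"
  by (auto simp: small_box_product_def topspace_box_product PiE_iff)

lemma openin_small_box_product_box:
  assumes "\<And>n. openin (X n) (U n)"
  shows "openin (small_box_product X p) {y. (\<forall>n. y n \<in> U n) \<and> finite {n. y n \<noteq> p n}}"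
proof -
  have "openin (box_product X) (Pi\<^sub>E UNIV U)"
    using assms by (auto simp: openin_box_product_iff)
  moreover have "{y. (\<forall>n. y n \<in> U n) \<and> finite {n. y n \<noteq> p n}}
      = Pi\<^sub>E UNIV U \<inter> {x \<in> topspace (box_product X). finite {n. x n \<noteq> p n}}"
    using openin_subset[OF assms] by (fastforce simp: topspace_box_product PiE_iff)
  ultimately show ?thesis
    unfolding small_box_product_def openin_subtopology by blast
qed

lemma openin_small_box_productE:
  assumes "openin (small_box_product X p) W" "x \<in> W"
  obtains U where "\<And>n. openin (X n) (U n)" "\<And>n. x n \<in> U n"
    "{y. (\<forall>n. y n \<in> U n) \<and> finite {n. y n \<noteq> p n}} \<subseteq> W"
proof -
  let ?S = "{x \<in> topspace (box_product X). finite {n. x n \<noteq> p n}}"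
  obtain T where T: "openin (box_product X) T" "W = T \<inter> ?S"
    using assms(1) unfolding small_box_product_def openin_subtopology by blast
  then obtain U where U: "\<forall>n. openin (X n) (U n)" "x \<in> Pi\<^sub>E UNIV U" "Pi\<^sub>E UNIV U \<subseteq> T"
    using assms(2) unfolding openin_box_product_iff by blast
  have "{y. (\<forall>n. y n \<in> U n) \<and> finite {n. y n \<noteq> p n}} \<subseteq> W"
    using U(1,3) T openin_subset[OF T(1)] by (fastforce simp: PiE_iff)
  with U show thesis
    by (intro that[of U]) (auto simp: PiE_iff)
qed

text \<open>Closedness of finite sets improves a finite intersection with \<open>P\<close> to an empty one.\<close>

lemma t1_space_avoid_nonaccumulating:
  assumes "t1_space X" "x \<in> topspace X" "P \<subseteq> topspace X" "x \<notin> P" "\<not> accumulates_at X P x"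
  obtains G where "openin X G" "x \<in> G" "G \<inter> P = {}"
proof -
  obtain W where W: "openin X W" "x \<in> W" "finite (W \<inter> P)"
    using assms by (auto simp: accumulates_at_def)
  have "closedin X (W \<inter> P)"
    using assms(1,3) W(3) by (auto simp: t1_space_closedin_finite)
  then have "openin X (W - W \<inter> P)"
    using W(1) by blast
  with W(2) assms(4) show thesis
    by (intro that[of "W - W \<inter> P"]) auto
qed

section \<open>Truncated boxes and accumulation\<close>

text \<open>
  The finitely many free factors form a list, so that countably many factor sets
  give countably many truncated boxes.
\<close>

definition truncated_box :: "(nat \<Rightarrow> 'a) \<Rightarrow> 'a set list \<Rightarrow> (nat \<Rightarrow> 'a) set" where
  "truncated_box p L = {y. \<forall>i. y i \<in> (if i < length L then L ! i else {p i})}"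

lemma truncated_box_map_upt:
  "truncated_box p (map f [0..<k]) = {y. \<forall>i. y i \<in> (if i < k then f i else {p i})}"
  by (auto simp: truncated_box_def)

text \<open>
  The sequence \<open>M i\<close> below is the common form of the two reasons why a point enters the
  truncated boxes late in coordinate \<open>i\<close>: its coordinate is not yet in \<open>C i k\<close>, or it differs from
  \<open>p i\<close> while coordinate \<open>i\<close> is still frozen.
\<close>

lemma truncated_box_meets_infinitely:
  fixes X :: "nat \<Rightarrow> 'a topology"
  assumes t1: "\<And>i. t1_space (X i)"
    and U: "\<And>i. openin (X i) (U i)"
    and inc: "\<And>i. incseq (C i)" and x0: "\<And>i. x i \<in> C i 0" and cover: "\<And>i. (\<Union>k. C i k) = U i"
    and catch: "\<And>i B. accumulates_at (X i) B (x i) \<Longrightarrow> \<exists>k. infinite (C i k \<inter> B)"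
    and k0: "\<And>i. k0 \<le> i \<Longrightarrow> x i = p i"
    and acc: "accumulates_at (small_box_product X p) A x"
  shows "\<exists>k\<ge>k0. infinite (truncated_box p (map (\<lambda>i. C i k) [0..<k]) \<inter> A)"
proof (rule ccontr)
  define M where "M i k = (if i < k then C i k else {p i})" for i k
  define F where "F k = {y. \<forall>i. y i \<in> M i k}" for k
  assume "\<not> ?thesis"
  then have fin: "finite (F k \<inter> A)" if "k0 \<le> k" for k
    using that by (auto simp: F_def M_def truncated_box_map_upt)
  have xC: "x i \<in> C i k" for i k
    using x0[of i] inc[of i] by (auto simp: incseq_def)
  have CU: "C i k \<subseteq> U i" for i k
    using cover[of i] by blast
  have xU: "x i \<in> U i" for i
    using xC CU by blast
  have xM: "x i \<in> M i k" if "k0 \<le> k" for i k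
    using that xC k0[of i] by (auto simp: M_def)
  have mono_M: "M i k \<subseteq> M i l" if "k0 \<le> k" "k \<le> l" for i k l
  proof (cases "i < k")
    case True
    then show ?thesis
      using that inc[of i] by (auto simp: M_def incseq_def)
  next
    case False
    then show ?thesis
      using that xM[of l i] k0[of i] by (auto simp: M_def)
  qed
  have mono_F: "F k \<subseteq> F l" if "k0 \<le> k" "k \<le> l" for k l
    using mono_M[OF that] by (auto simp: F_def)
  \<comment> \<open>The \<open>i\<close>-th coordinates of the points that are kept out of some \<open>F k\<close> by coordinate \<open>i\<close>.\<close>
  define P where "P i = {a i |a k. a \<in> A \<and> k0 \<le> k \<and> a \<in> F (Suc k) \<and> a i \<notin> M i k}" for i
  have "\<exists>G. openin (X i) G \<and> x i \<in> G \<and> G \<inter> P i = {}" for i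
  proof -
    have "\<not> accumulates_at (X i) (P i) (x i)"
    proof
      assume "accumulates_at (X i) (P i) (x i)"
      then obtain k where k: "infinite (C i k \<inter> P i)"
        using catch by blast
      \<comment> \<open>\<open>M i j\<close> is \<open>C i j\<close> only once coordinate \<open>i\<close> is free, that is, for \<open>i < j\<close>.\<close>
      define j where "j = Max {k, k0, Suc i}"
      have j: "k \<le> j" "k0 \<le> j" "i < j"
        by (auto simp: j_def)
      have "C i k \<subseteq> M i j"
        using inc[of i] j by (auto simp: M_def incseq_def)
      moreover have "M i j \<inter> P i \<subseteq> (\<lambda>a. a i) ` (F j \<inter> A)"
      proof
        fix b assume "b \<in> M i j \<inter> P i"
        then obtain a l where a: "b = a i" "a i \<in> M i j" "a \<in> A" "k0 \<le> l" "a \<in> F (Suc l)" "a i \<notin> M i l"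
          by (auto simp: P_def)
        have "l < j"
          using mono_M[of j l i] a j by (meson in_mono not_le)
        then have "a \<in> F j"
          using mono_F[of "Suc l" j] a by auto
        then show "b \<in> (\<lambda>a. a i) ` (F j \<inter> A)"
          using a by blast
      qed
      ultimately have "C i k \<inter> P i \<subseteq> (\<lambda>a. a i) ` (F j \<inter> A)"
        by blast
      with k show False
        using fin[OF j(2)] by (meson finite_imageI finite_subset)
    qed
    moreover have "A \<subseteq> topspace (small_box_product X p)"
      using acc by (simp add: accumulates_at_def)
    then have "P i \<subseteq> topspace (X i)"
      by (auto simp: P_def topspace_small_box_product)
    moreover have "x i \<notin> P i"
    proof
      assume "x i \<in> P i"
      then obtain a k where "x i = a i" "k0 \<le> k" "a i \<notin> M i k"
        unfolding P_def by blast
      then show False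
        using xM[of k i] by simp
    qed
    moreover have "x i \<in> topspace (X i)"
      using xU[of i] openin_subset[OF U] by blast
    ultimately show ?thesis
      using t1_space_avoid_nonaccumulating[OF t1] by metis
  qed
  then obtain V where V: "\<And>i. openin (X i) (V i)" "\<And>i. x i \<in> V i" "\<And>i. V i \<inter> P i = {}"
    by metis
  define B where "B = {y. (\<forall>i. y i \<in> U i \<inter> V i) \<and> finite {i. y i \<noteq> p i}}"
  have "finite {i. x i \<noteq> p i}"
    using acc by (auto simp: accumulates_at_def topspace_small_box_product)
  then have "x \<in> B"
    using xU V(2) by (simp add: B_def)
  moreover have "openin (small_box_product X p) B"
    unfolding B_def by (intro openin_small_box_product_box openin_Int U V)
  ultimately have "infinite (B \<inter> A)"
    using acc by (simp add: accumulates_at_def)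
  moreover have "B \<inter> A \<subseteq> F k0 \<inter> A"
  proof
    fix a assume a: "a \<in> B \<inter> A"
    have "\<exists>k\<ge>k0. a \<in> F k"
    proof -
      have supp: "finite {i. a i \<noteq> p i}"
        using a by (simp add: B_def)
      have "\<exists>k. a i \<in> C i k" for i
        using a cover[of i] by (auto simp: B_def)
      then obtain r where r: "\<And>i. a i \<in> C i (r i)"
        by metis
      \<comment> \<open>Outside \<open>S\<close>, \<open>a i = p i = x i\<close> lies in \<open>M i k\<close> for all \<open>k \<ge> k0\<close>; the \<open>k\<close> below is late enough for \<open>S\<close>.\<close>
      define S where "S = {i. a i \<noteq> p i} \<union> {..<k0}"
      define k where "k = Max (insert k0 ((\<lambda>i. max (Suc i) (r i)) ` S))"
      have "finite S"
        using supp by (simp add: S_def)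
      then have k: "k0 \<le> k" "\<And>i. i \<in> S \<Longrightarrow> max (Suc i) (r i) \<le> k"
        unfolding k_def by (auto intro!: Max_ge simp del: max.bounded_iff)
      have "a i \<in> M i k" for i
      proof (cases "i \<in> S")
        case True
        then have "i < k" "r i \<le> k"
          using k(2)[of i] by auto
        then show ?thesis
          using r[of i] inc[of i] by (auto simp: M_def incseq_def)
      next
        case False
        then have "a i = x i"
          using k0[of i] by (auto simp: S_def)
        then show ?thesis
          using xM[OF k(1)] by simp
      qed
      then show ?thesis
        using k(1) by (auto simp: F_def)
    qed
    then obtain k where "k0 \<le> k" "a \<in> F k"
      by blast
    then have "a \<in> F k0"
    proof (induction k rule: dec_induct)
      case (step k)
      have "a i \<in> M i k" for i
        using a step.hyps(1) step.prems V(3)[of i] by (auto simp: B_def P_def)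
      then show ?case
        using step.IH by (simp add: F_def)
    qed
    with a show "a \<in> F k0 \<inter> A"
      by simp
  qed
  ultimately show False
    using fin[of k0] by (meson finite_subset order_refl)
qed

section \<open>The countable Pytkeev network\<close>

theorem theorem3p6:
  fixes X :: "nat \<Rightarrow> 'a topology" and p :: "nat \<Rightarrow> 'a"
  assumes "\<And>n. p n \<in> topspace (X n)"
    and "\<And>n. t1_space (X n)"
    and "\<And>n. \<exists>\<N>. countable \<N> \<and> pytkeev_network (X n) \<N>"
  shows "\<exists>\<N>. countable \<N> \<and> pytkeev_network (small_box_product X p) \<N>"
proof -
  let ?Y = "small_box_product X p"
  obtain \<N> where \<N>: "\<And>n. countable (\<N> n)" "\<And>n. pytkeev_network (X n) (\<N> n)"
    using assms(3) by metis
  define \<U> where "\<U> = (\<Union>n. Union ` {\<F>. finite \<F> \<and> \<F> \<subseteq> \<N> n})"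
  have "countable \<U>"
    unfolding \<U>_def using \<N>(1) by (intro countable_UN countable_image countable_Collect_finite_subset) auto
  define \<K> where "\<K> = truncated_box p ` lists \<U> \<inter> Pow (topspace ?Y)"
  have "countable \<K>"
    using \<open>countable \<U>\<close> by (simp add: \<K>_def)
  have key: "(\<exists>K\<in>\<K>. x \<in> K \<and> K \<subseteq> W) \<and>
      (\<forall>A. accumulates_at ?Y A x \<longrightarrow> (\<exists>K\<in>\<K>. K \<subseteq> W \<and> infinite (K \<inter> A)))"
    if W: "openin ?Y W" "x \<in> W" for x W
  proof -
    obtain U where U: "\<And>n. openin (X n) (U n)" "\<And>n. x n \<in> U n"
        "{y. (\<forall>n. y n \<in> U n) \<and> finite {n. y n \<noteq> p n}} \<subseteq> W"
      using openin_small_box_productE[OF W] by blast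
    have "\<forall>i. \<exists>C. range C \<subseteq> Union ` {\<F>. finite \<F> \<and> \<F> \<subseteq> \<N> i} \<and> incseq C \<and> x i \<in> C 0 \<and> (\<Union>k. C k) = U i \<and>
        (\<forall>B. accumulates_at (X i) B (x i) \<longrightarrow> (\<exists>k. infinite (C k \<inter> B)))"
        (is "\<forall>i. \<exists>C. ?exhausts i C")
      by (intro allI pytkeev_exhaustion \<N> U)
    from choice[OF this] obtain C where "\<forall>i. ?exhausts i (C i)" ..
    then have C: "\<And>i. range (C i) \<subseteq> Union ` {\<F>. finite \<F> \<and> \<F> \<subseteq> \<N> i}"
        "\<And>i. incseq (C i)" "\<And>i. x i \<in> C i 0" "\<And>i. (\<Union>k. C i k) = U i"
        "\<And>i B. accumulates_at (X i) B (x i) \<Longrightarrow> \<exists>k. infinite (C i k \<inter> B)"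
      by blast+
    have "x \<in> topspace ?Y"
      using W openin_subset by blast
    then have "finite {n. x n \<noteq> p n}"
      by (simp add: topspace_small_box_product)
    then obtain k0 where "\<forall>n\<in>{n. x n \<noteq> p n}. n < k0"
      using finite_nat_set_iff_bounded by blast
    then have k0: "x i = p i" if "k0 \<le> i" for i
      using that by fastforce
    define F where "F k = truncated_box p (map (\<lambda>i. C i k) [0..<k])" for k
    have F_W: "F k \<subseteq> W" if "k0 \<le> k" for k
    proof
      fix y assume "y \<in> F k"
      then have y: "y i \<in> (if i < k then C i k else {p i})" for i
        by (simp add: F_def truncated_box_map_upt)
      have "y i \<in> U i" for i
        using y[of i] C(4)[of i] U(2)[of i] k0[of i] that by (auto split: if_splits)
      moreover have "{i. y i \<noteq> p i} \<subseteq> {..<k}"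
      proof
        fix i assume "i \<in> {i. y i \<noteq> p i}"
        then show "i \<in> {..<k}"
          using y[of i] by (auto split: if_splits)
      qed
      then have "finite {i. y i \<noteq> p i}"
        by (rule finite_subset) simp
      ultimately show "y \<in> W"
        using U(3) by blast
    qed
    have F_\<K>: "F k \<in> \<K>" if "k0 \<le> k" for k
    proof -
      have "C i k \<in> \<U>" for i
        unfolding \<U>_def by (intro UN_I[of i] subsetD[OF C(1)] UNIV_I rangeI)
      then have "F k \<in> truncated_box p ` lists \<U>"
        unfolding F_def by (intro imageI) auto
      moreover have "F k \<subseteq> topspace ?Y"
        using F_W[OF that] openin_subset[OF W(1)] by blast
      ultimately show ?thesis
        by (simp add: \<K>_def)
    qed
    have "x i \<in> C i k0" for i
      using C(2,3)[of i] by (auto simp: incseq_def)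
    then have "x \<in> F k0"
      using k0 by (auto simp: F_def truncated_box_map_upt)
    then have "\<exists>K\<in>\<K>. x \<in> K \<and> K \<subseteq> W"
      using F_\<K> F_W by blast
    moreover have "\<exists>K\<in>\<K>. K \<subseteq> W \<and> infinite (K \<inter> A)" if "accumulates_at ?Y A x" for A
    proof -
      have "\<exists>k\<ge>k0. infinite (F k \<inter> A)"
        unfolding F_def
        by (rule truncated_box_meets_infinitely[OF assms(2) U(1) C(2-5) k0 that])
      then show ?thesis
        using F_\<K> F_W by blast
    qed
    ultimately show ?thesis
      by blast
  qed
  have "\<K> \<subseteq> Pow (topspace ?Y)"
    by (simp add: \<K>_def)
  with key have "pytkeev_network ?Y \<K>"
    unfolding pytkeev_network_def pytkeev_network_at_def network_at_def by blast
  with \<open>countable \<K>\<close> show ?thesis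
    by blast
qed

end
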